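(* Let $G$ be a simple graph and let $(K,\mathsf m_K)$ be the core of the marked graph $(G,\mathbbm 1)$. Then $$X_G=D_{(K,\mathsf m_K)}(z_{w,0}=\mathfrak{st}_w,\ y=0),$$ i.e. $X_G$ is obtained from the $D$-polynomial of the core by substituting $z_{w,0}\mapsto\mathfrak{st}_w$ for every $w\ge1$ and $y\mapsto 0$.
   Context: $X_G=\sum_\kappa x_{\kappa(v_1)}\cdots x_{\kappa(v_n)}$ is the chromatic symmetric function of a simple graph $G$ with vertices $v_1,\dots,v_n$ (sum over proper colorings $\kappa:V(G)\to\{1,2,\dots\}$). $St_w$ is the star graph on $w$ vertices and $\mathfrak{st}_w=X_{St_w}$. Marks are pairs $(w,d)$ of integers with $w\ge1,d\ge0,w\ge d+1$, with dot-sum $(w,d)\dotplus(w',d')=(w+w',d+d'+1)$; a marked graph is a graph (loops and multiple edges allowed) with a mark on each vertex, and $(G,\mathbbm 1)$ gives every vertex the mark $(1,0)$. Contracting a non-loop edge $e=uv$ merges $u,v$ into a new vertex inheriting all other incident edges, with mark $\mathsf m(u)\dotplus\mathsf m(v)$. The $M$-polynomial in commuting indeterminates $y$, $z_{w,d}$: edgeless with marks $(w_i,d_i)$ gives $\prod z_{w_i,d_i}$; a loop $e$ gives $M_{(G,\mathsf m)}=y\,M_{(G\setminus e,\mathsf m)}$; a non-loop edge $e$ gives $M_{(G,\mathsf m)}=M_{(G\setminus e,\mathsf m)}+M_{(G/e,\mathsf m/e)}$. With $D_{\bullet_{w,d}}=\sum_{i=0}^d(-1)^i\binom di z_{w-i,0}z_{1,0}^i$,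 the $D$-polynomial is $M$ with each $z_{w,d}$ replaced by $D_{\bullet_{w,d}}$ (a polynomial in $y$ and the $z_{w,0}$). A vertex is absorbable if it has degree $1$ and mark $(1,0)$; an edge is absorbable if incident with an absorbable vertex. Absorbing an absorbable edge $e=uv$, $v$ absorbable, $\mathsf m(u)=(w,d)$, contracts $e$ and gives the resulting vertex mark $(w+1,d)$. The core is obtained by absorbing absorbable edges until none remain. *)

theory Defs
  imports Complex_Main "HOL-Library.Multiset" "HOL-Library.FuncSet" "HOL-Library.Poly_Mapping"
begin

section \<open>Formal power series in arbitrarily many variables\<close>

text \<open>
  A monomial in the variables \<^typ>\<open>'x\<close> is a finite multiset of variables, multiplied by
  multiset union. A power series is an arbitrary function from monomials to coefficients.
\<close>

typedef ('x, 'c) mpser = "UNIV :: ('x multiset \<Rightarrow> 'c) set"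
  morphisms mcoeff Abs_mpser by auto

declare Abs_mpser_inverse [OF UNIV_I, simp]

lemma mpser_eqI: "(\<And>A. mcoeff f A = mcoeff g A) \<Longrightarrow> f = g"
  using mcoeff_inject by blast

lemma finite_submultisets [simp]: "finite {B. B \<subseteq># (A :: 'x multiset)}"
proof (induction A)
  case (add x A)
  have "{B. B \<subseteq># add_mset x A} \<subseteq> {B. B \<subseteq># A} \<union> add_mset x ` {B. B \<subseteq># A}"
  proof
    fix B assume "B \<in> {B. B \<subseteq># add_mset x A}"
    then have B: "B \<subseteq># add_mset x A" by simp
    show "B \<in> {B. B \<subseteq># A} \<union> add_mset x ` {B. B \<subseteq># A}"
    proof (cases "x \<in># B")
      case True
      then obtain C where "B = add_mset x C" by (metis insert_DiffM)
      then show ?thesis using B by auto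
    next
      case False
      then show ?thesis using B
        by (metis CollectI UnI1 diff_single_trivial subset_eq_diff_conv add_mset_add_single)
    qed
  qed
  then show ?case using add finite_subset by (metis finite_Un finite_imageI)
qed simp

instantiation mpser :: (type, comm_ring_1) comm_ring_1
begin

definition "0 = Abs_mpser (\<lambda>A. 0)"
definition "1 = Abs_mpser (\<lambda>A. if A = {#} then 1 else 0)"
definition "f + g = Abs_mpser (\<lambda>A. mcoeff f A + mcoeff g A)"
definition "f - g = Abs_mpser (\<lambda>A. mcoeff f A - mcoeff g A)"
definition "- f = Abs_mpser (\<lambda>A. - mcoeff f A)"
definition "f * g = Abs_mpser (\<lambda>A. \<Sum>B | B \<subseteq># A. mcoeff f B * mcoeff g (A - B))"

instance
proof
  fix a b c :: "('a, 'b) mpser"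
  show "a + b + c = a + (b + c)" "a + b = b + a" "0 + a = a" "- a + a = 0" "a - b = a + - b"
    by (simp_all add: plus_mpser_def minus_mpser_def uminus_mpser_def zero_mpser_def
        mcoeff_inverse algebra_simps)
  show "(0 :: ('a, 'b) mpser) \<noteq> 1"
  proof
    assume "(0 :: ('a, 'b) mpser) = 1"
    then have "mcoeff (0 :: ('a, 'b) mpser) {#} = mcoeff 1 {#}" by simp
    then show False by (simp add: zero_mpser_def one_mpser_def)
  qed
  show "(a + b) * c = a * c + b * c"
    by (simp add: plus_mpser_def times_mpser_def algebra_simps sum.distrib)
  show "a * b = b * a"
  proof (rule mpser_eqI)
    fix A :: "'a multiset"
    have dd: "A - (A - B) = B" if "B \<subseteq># A" for B
      using that by (auto simp: multiset_eq_iff subseteq_mset_def)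
    have "(\<Sum>B | B \<subseteq># A. mcoeff a B * mcoeff b (A - B)) =
          (\<Sum>B | B \<subseteq># A. mcoeff b B * mcoeff a (A - B))"
      by (rule sum.reindex_bij_witness [where i = "\<lambda>B. A - B" and j = "\<lambda>B. A - B"])
        (auto simp: mult.commute dd)
    then show "mcoeff (a * b) A = mcoeff (b * a) A" by (simp add: times_mpser_def)
  qed
  show "1 * a = a"
  proof (rule mpser_eqI)
    fix A
    have "(\<Sum>B | B \<subseteq># A. (if B = {#} then 1 else 0) * mcoeff a (A - B)) =
          (\<Sum>B | B \<subseteq># A. if B = {#} then mcoeff a A else 0)"
      by (rule sum.cong) auto
    also have "\<dots> = mcoeff a A" by (simp add: sum.delta)
    finally show "mcoeff (1 * a) A = mcoeff a A" by (simp add: times_mpser_def one_mpser_def)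
  qed
  show "a * b * c = a * (b * c)"
  proof (rule mpser_eqI)
    fix A
    have "mcoeff (a * b * c) A =
      (\<Sum>(B, C) \<in> Sigma {B. B \<subseteq># A} (\<lambda>B. {C. C \<subseteq># B}).
         mcoeff a C * mcoeff b (B - C) * mcoeff c (A - B))"
      by (simp add: times_mpser_def sum_distrib_right sum.Sigma)
    also have "\<dots> =
      (\<Sum>(C, D) \<in> Sigma {C. C \<subseteq># A} (\<lambda>C. {D. D \<subseteq># A - C}).
         mcoeff a C * (mcoeff b D * mcoeff c (A - C - D)))"
    proof (rule sum.reindex_bij_witness [where i = "\<lambda>(C, D). (C + D, C)"
            and j = "\<lambda>(B, C). (C, B - C)"], goal_cases)
      case (1 p)
      then show ?case by auto
    next
      case (2 p)
      then show ?case
        by (auto intro: subset_mset.order_trans simp: subset_mset.diff_add_assoc2 subset_eq_diff_conv)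
    next
      case (3 p)
      then show ?case by auto
    next
      case (4 p)
      then obtain C D where p: "p = (C, D)" "C \<subseteq># A" "D \<subseteq># A - C" by auto
      then have "C + D \<subseteq># A"
        by (metis subset_mset.add_left_mono subset_mset.add_diff_inverse)
      then show ?case using p by auto
    next
      case (5 p)
      then obtain B C where p: "p = (B, C)" "B \<subseteq># A" "C \<subseteq># B" by auto
      then have "A - C - (B - C) = A - B"
        by (metis diff_diff_add_mset subset_mset.add_diff_inverse)
      then show ?case using p by (simp add: mult.assoc)
    qed
    also have "\<dots> = mcoeff (a * (b * c)) A"
      by (simp add: times_mpser_def sum_distrib_left sum.Sigma)
    finally show "mcoeff (a * b * c) A = mcoeff (a * (b * c)) A" .
  qed
qed

end

section \<open>Simple graphs and chromatic symmetric functions\<close>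

definition simple_graph :: "'a set \<Rightarrow> 'a set set \<Rightarrow> bool" where
  "simple_graph V E \<longleftrightarrow> finite V \<and> (\<forall>e\<in>E. e \<subseteq> V \<and> card e = 2)"

text \<open>Colours are the positive integers; colourings are undefined outside \<^term>\<open>V\<close>.\<close>

definition proper_colorings :: "'a set \<Rightarrow> 'a set set \<Rightarrow> ('a \<Rightarrow> nat) set" where
  "proper_colorings V E =
     {\<kappa> \<in> V \<rightarrow>\<^sub>E {1..}. \<forall>u v. {u, v} \<in> E \<longrightarrow> \<kappa> u \<noteq> \<kappa> v}"

text \<open>
  The coefficient of a monomial \<^term>\<open>A\<close> in the sum over all proper colourings of the monomials
  \<open>x\<^bsub>\<kappa>(v\<^sub>1)\<^esub> \<cdots> x\<^bsub>\<kappa>(v\<^sub>n)\<^esub>\<close> is the number of colourings with monomial \<^term>\<open>A\<close>.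
\<close>

definition chrom_sym :: "'a set \<Rightarrow> 'a set set \<Rightarrow> (nat, int) mpser" where
  "chrom_sym V E = Abs_mpser (\<lambda>A.
     int (card {\<kappa> \<in> proper_colorings V E. image_mset \<kappa> (mset_set V) = A}))"

lemma finite_colorings_of_monomial:
  assumes "finite V"
  shows "finite {\<kappa> \<in> proper_colorings V E. image_mset \<kappa> (mset_set V) = A}"
proof (rule finite_subset)
  show "{\<kappa> \<in> proper_colorings V E. image_mset \<kappa> (mset_set V) = A} \<subseteq> V \<rightarrow>\<^sub>E set_mset A"
  proof
    fix \<kappa> assume "\<kappa> \<in> {\<kappa> \<in> proper_colorings V E. image_mset \<kappa> (mset_set V) = A}"
    then have "\<kappa> \<in> extensional V" and A: "A = image_mset \<kappa> (mset_set V)"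
      by (auto simp: proper_colorings_def PiE_def)
    moreover have "set_mset A = \<kappa> ` V" using A assms by simp
    ultimately show "\<kappa> \<in> V \<rightarrow>\<^sub>E set_mset A" by (simp add: PiE_iff)
  qed
  show "finite (V \<rightarrow>\<^sub>E set_mset A)" using assms by (simp add: finite_PiE)
qed

text \<open>The star on \<^term>\<open>w\<close> vertices, with centre \<open>0\<close>.\<close>

definition star_verts :: "nat \<Rightarrow> nat set" where
  "star_verts w = {0..<w}"

definition star_edges :: "nat \<Rightarrow> nat set set" where
  "star_edges w = {{0, i} | i. i \<in> {1..<w}}"

definition star_csf :: "nat \<Rightarrow> (nat, int) mpser" where
  "star_csf w = chrom_sym (star_verts w) (star_edges w)"

section \<open>Marked graphs\<close>

text \<open>A mark \<open>(w, d)\<close> is a pair of naturals satisfying \<open>valid_mark\<close>.\<close>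

type_synonym mark = "nat \<times> nat"

definition valid_mark :: "mark \<Rightarrow> bool" where
  "valid_mark a \<longleftrightarrow> fst a \<ge> 1 \<and> fst a \<ge> snd a + 1"

definition dotsum :: "mark \<Rightarrow> mark \<Rightarrow> mark" where
  "dotsum a b = (fst a + fst b, snd a + snd b + 1)"

text \<open>
  An edge is represented by its set of endpoints, so that a loop at \<^term>\<open>v\<close> is \<^term>\<open>{v}\<close>;
  parallel edges are accounted for by multiplicities.
\<close>

record 'a marked_graph =
  verts :: "'a set"
  marks :: "'a \<Rightarrow> mark"
  edges :: "'a set multiset"

definition wf_marked :: "'a marked_graph \<Rightarrow> bool" where
  "wf_marked G \<longleftrightarrow> finite (verts G) \<and>
     (\<forall>e \<in># edges G. \<exists>u\<in>verts G. \<exists>v\<in>verts G. e = {u, v}) \<and>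
     (\<forall>v \<in> verts G. valid_mark (marks G v))"

definition unit_marked :: "'a set \<Rightarrow> 'a set set \<Rightarrow> 'a marked_graph" where
  "unit_marked V E = \<lparr>verts = V, marks = (\<lambda>v. (1, 0)), edges = mset_set E\<rparr>"

definition delete_edge :: "'a set \<Rightarrow> 'a marked_graph \<Rightarrow> 'a marked_graph" where
  "delete_edge e G = G\<lparr>edges := edges G - {#e#}\<rparr>"

text \<open>The vertex resulting from the contraction of an edge \<^term>\<open>{u, v}\<close> is again called \<^term>\<open>u\<close>.\<close>

definition merge :: "'a \<Rightarrow> 'a \<Rightarrow> 'a \<Rightarrow> 'a" where
  "merge u v x = (if x = v then u else x)"

definition contract_edge :: "'a \<Rightarrow> 'a \<Rightarrow> 'a marked_graph \<Rightarrow> 'a marked_graph" where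
  "contract_edge u v G =
     \<lparr>verts = verts G - {v},
      marks = (marks G)(u := dotsum (marks G u) (marks G v)),
      edges = image_mset (image (merge u v)) (edges G - {#{u, v}#})\<rparr>"

section \<open>The polynomials \<open>M\<close> and \<open>D\<close>\<close>

text \<open>
  Polynomials over the integers are finitely supported functions on monomials, where a monomial
  is a multiset of indeterminates. The indeterminates are \<open>y\<close> and \<open>z\<^bsub>w,d\<^esub>\<close>; those
  \<open>z\<^bsub>w,d\<^esub>\<close> for which \<open>(w, d)\<close> is not a valid mark play no role.
\<close>

datatype indet = Y | Z nat nat

type_synonym mpoly = "indet multiset \<Rightarrow>\<^sub>0 int"

definition var :: "indet \<Rightarrow> mpoly" where
  "var x = Poly_Mapping.single {#x#} 1"

definition subst_poly :: "(indet \<Rightarrow> 'b :: comm_ring_1) \<Rightarrow> mpoly \<Rightarrow> 'b" where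
  "subst_poly \<sigma> p =
     (\<Sum>A \<in> Poly_Mapping.keys p. of_int (Poly_Mapping.lookup p A) * (\<Prod>x\<in>#A. \<sigma> x))"

text \<open>
  \<open>M_value G P\<close> holds iff \<^term>\<open>P\<close> can be computed from \<^term>\<open>G\<close> by the recursion rules, with any
  choice of edges. The value is unique, see \<open>M_value_unique\<close> below.
\<close>

inductive M_value :: "'a marked_graph \<Rightarrow> mpoly \<Rightarrow> bool" where
  edgeless: "edges G = {#} \<Longrightarrow>
    M_value G (\<Prod>v\<in>verts G. var (Z (fst (marks G v)) (snd (marks G v))))"
| loop: "{v} \<in># edges G \<Longrightarrow> M_value (delete_edge {v} G) P \<Longrightarrow> M_value G (var Y * P)"
| nonloop: "{u, v} \<in># edges G \<Longrightarrow> u \<noteq> v \<Longrightarrow> M_value (delete_edge {u, v} G) P \<Longrightarrow>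
    M_value (contract_edge u v G) Q \<Longrightarrow> M_value G (P + Q)"

definition M_poly :: "'a marked_graph \<Rightarrow> mpoly" where
  "M_poly G = (THE P. M_value G P)"

definition D_dot :: "nat \<Rightarrow> nat \<Rightarrow> mpoly" where
  "D_dot w d = (\<Sum>i=0..d. (-1) ^ i * of_nat (d choose i) * var (Z (w - i) 0) * var (Z 1 0) ^ i)"

definition D_poly :: "'a marked_graph \<Rightarrow> mpoly" where
  "D_poly G = subst_poly (\<lambda>x. case x of Y \<Rightarrow> var Y | Z w d \<Rightarrow> D_dot w d) (M_poly G)"

subsection \<open>Well-definedness of \<open>M\<close>\<close>

lemma wf_edgeE:
  assumes "wf_marked G" "e \<in># edges G"
  obtains a b where "a \<in> verts G" "b \<in> verts G" "e = {a, b}"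
  using assms unfolding wf_marked_def by meson

lemma wf_edge_subset: "wf_marked G \<Longrightarrow> e \<in># edges G \<Longrightarrow> e \<subseteq> verts G"
  by (erule wf_edgeE) auto

lemma wf_edgeD:
  assumes "wf_marked G" "{u, v} \<in># edges G"
  shows "u \<in> verts G" "v \<in> verts G"
  using wf_edge_subset [OF assms] by auto

lemma wf_delete: "wf_marked G \<Longrightarrow> wf_marked (delete_edge e G)"
  unfolding wf_marked_def delete_edge_def by (auto dest: in_diffD)

lemma valid_dotsum: "valid_mark a \<Longrightarrow> valid_mark b \<Longrightarrow> valid_mark (dotsum a b)"
  by (auto simp: valid_mark_def dotsum_def)

lemma wf_contract:
  assumes "wf_marked G" "{u, v} \<in># edges G" "u \<noteq> v"
  shows "wf_marked (contract_edge u v G)"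
proof -
  have uv: "u \<in> verts G" "v \<in> verts G" using wf_edgeD assms by metis+
  have "\<exists>a\<in>verts G - {v}. \<exists>b\<in>verts G - {v}. merge u v ` e = {a, b}"
    if e: "e \<in># edges G - {#{u, v}#}" for e
  proof -
    obtain a b where ab: "a \<in> verts G" "b \<in> verts G" "e = {a, b}"
      using wf_edgeE [OF assms(1) in_diffD [OF e]] .
    then have "merge u v a \<in> verts G - {v}" "merge u v b \<in> verts G - {v}"
      using uv assms(3) by (auto simp: merge_def)
    moreover have "merge u v ` e = {merge u v a, merge u v b}" using ab by simp
    ultimately show ?thesis by blast
  qed
  then show ?thesis
    using assms(1) uv by (auto simp: wf_marked_def contract_edge_def valid_dotsum)
qed

lemma size_delete: "e \<in># edges G \<Longrightarrow> size (edges (delete_edge e G)) < size (edges G)"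
  by (simp add: delete_edge_def size_Diff1_less)

lemma size_contract: "{u, v} \<in># edges G \<Longrightarrow> size (edges (contract_edge u v G)) < size (edges G)"
  by (simp add: contract_edge_def size_Diff1_less)

lemma M_value_exists: "wf_marked G \<Longrightarrow> \<exists>P. M_value G P"
proof (induction "size (edges G)" arbitrary: G rule: less_induct)
  case less
  show ?case
  proof (cases "edges G = {#}")
    case True
    then show ?thesis using edgeless by blast
  next
    case False
    then obtain e where e: "e \<in># edges G" by auto
    then obtain u v where uv: "e = {u, v}"
      using wf_edgeE [OF less.prems] by metis
    obtain P where P: "M_value (delete_edge e G) P"
      using less.hyps size_delete [OF e] wf_delete [OF less.prems] by blast
    show ?thesis
    proof (cases "u = v")
      case True
      then show ?thesis using loop e P uv by (metis insert_absorb2)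
    next
      case False
      have e': "{u, v} \<in># edges G" "M_value (delete_edge {u, v} G) P" using e P uv by auto
      obtain Q where Q: "M_value (contract_edge u v G) Q"
        using less.hyps [OF size_contract [OF e'(1)] wf_contract [OF less.prems e'(1) False]] ..
      show ?thesis using nonloop [OF e'(1) False e'(2) Q] ..
    qed
  qed
qed

definition marked_iso :: "('a \<Rightarrow> 'b) \<Rightarrow> 'a marked_graph \<Rightarrow> 'b marked_graph \<Rightarrow> bool" where
  "marked_iso f G H \<longleftrightarrow> inj_on f (verts G) \<and> verts H = f ` verts G \<and>
     (\<forall>v\<in>verts G. marks H (f v) = marks G v) \<and> edges H = image_mset (image f) (edges G)"

lemma marked_iso_delete:
  assumes "marked_iso f G H" "e \<in># edges G"
  shows "marked_iso f (delete_edge e G) (delete_edge (f ` e) H)"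
  using assms by (simp add: marked_iso_def delete_edge_def image_mset_Diff)

lemma marked_iso_contract:
  assumes iso: "marked_iso f G H" and wf: "wf_marked G" and uv: "{u, v} \<in># edges G" "u \<noteq> v"
  shows "marked_iso f (contract_edge u v G) (contract_edge (f u) (f v) H)"
proof -
  have inj: "inj_on f (verts G)" using iso by (simp add: marked_iso_def)
  have V: "u \<in> verts G" "v \<in> verts G" using wf_edgeD wf uv by metis+
  have "edges (contract_edge (f u) (f v) H) =
      image_mset (image (merge (f u) (f v))) (image_mset (image f) (edges G) - {#f ` {u, v}#})"
    using iso by (simp add: marked_iso_def contract_edge_def)
  also have "\<dots> = image_mset (image (merge (f u) (f v))) (image_mset (image f) (edges G - {#{u, v}#}))"
    using uv(1) by (simp add: image_mset_Diff)
  also have "\<dots> = image_mset (\<lambda>e. merge (f u) (f v) ` f ` e) (edges G - {#{u, v}#})"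
    by (simp add: multiset.map_comp comp_def)
  also have "\<dots> = image_mset (\<lambda>e. f ` merge u v ` e) (edges G - {#{u, v}#})"
  proof (rule image_mset_cong)
    fix e assume "e \<in># edges G - {#{u, v}#}"
    then have sub: "e \<subseteq> verts G" using wf_edge_subset [OF wf] in_diffD by metis
    have "merge (f u) (f v) (f x) = f (merge u v x)" if "x \<in> e" for x
    proof -
      have "x \<in> verts G" using that sub by blast
      then show ?thesis using inj V by (auto simp: merge_def dest: inj_onD)
    qed
    then show "merge (f u) (f v) ` f ` e = f ` merge u v ` e"
      by (simp add: image_image)
  qed
  also have "\<dots> = image_mset (image f) (edges (contract_edge u v G))"
    by (simp add: contract_edge_def multiset.map_comp comp_def)
  finally have E: "edges (contract_edge (f u) (f v) H) = \<dots>" .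
  have "f ` verts G - {f v} = f ` (verts G - {v})"
    using inj V by (auto dest: inj_onD)
  moreover have "inj_on f (verts G - {v})" using inj inj_on_subset by blast
  moreover have "marks (contract_edge (f u) (f v) H) (f x) = marks (contract_edge u v G) x"
    if "x \<in> verts G - {v}" for x
    using that inj V iso by (auto simp: contract_edge_def marked_iso_def dest: inj_onD)
  ultimately show ?thesis
    using iso E by (auto simp: marked_iso_def contract_edge_def)
qed

lemma M_value_iso:
  "M_value G P \<Longrightarrow> wf_marked G \<Longrightarrow> marked_iso f G H \<Longrightarrow> M_value H P"
proof (induction arbitrary: H rule: M_value.induct)
  case (edgeless G)
  have "edges H = {#}" using edgeless by (simp add: marked_iso_def)
  then have "M_value H (\<Prod>v\<in>verts H. var (Z (fst (marks H v)) (snd (marks H v))))"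
    by (rule M_value.edgeless)
  also have "(\<Prod>v\<in>verts H. var (Z (fst (marks H v)) (snd (marks H v)))) =
      (\<Prod>v\<in>verts G. var (Z (fst (marks G v)) (snd (marks G v))))"
    using edgeless.prems(2) by (simp add: marked_iso_def prod.reindex)
  finally show ?case .
next
  case (loop v G P)
  have "f ` {v} \<in># edges H" using loop by (auto simp: marked_iso_def)
  moreover have "M_value (delete_edge (f ` {v}) H) P"
    by (rule loop.IH [OF wf_delete [OF loop.prems(1)]
          marked_iso_delete [OF loop.prems(2) loop.hyps(1)]])
  ultimately show ?case using M_value.loop by (metis image_empty image_insert)
next
  case (nonloop u v G P Q)
  have V: "u \<in> verts G" "v \<in> verts G" using wf_edgeD nonloop.prems(1) nonloop.hyps(1) by metis+
  then have "f u \<noteq> f v" using nonloop by (auto simp: marked_iso_def dest: inj_onD)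
  moreover have "f ` {u, v} \<in># edges H" using nonloop.hyps(1) nonloop.prems(2)
    unfolding marked_iso_def by (metis imageI set_image_mset)
  then have "{f u, f v} \<in># edges H" by simp
  moreover have "M_value (delete_edge (f ` {u, v}) H) P"
    by (rule nonloop.IH(1) [OF wf_delete [OF nonloop.prems(1)]
          marked_iso_delete [OF nonloop.prems(2) nonloop.hyps(1)]])
  then have "M_value (delete_edge {f u, f v} H) P" by simp
  moreover have "M_value (contract_edge (f u) (f v) H) Q"
    by (rule nonloop.IH(2) [OF wf_contract [OF nonloop.prems(1) nonloop.hyps(1,2)]
          marked_iso_contract [OF nonloop.prems(2,1) nonloop.hyps(1,2)]])
  ultimately show ?case by (metis M_value.nonloop)
qed

lemma M_value_contract_swap:
  assumes "wf_marked G" "{u, v} \<in># edges G" "u \<noteq> v" "M_value (contract_edge u v G) P"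
  shows "M_value (contract_edge v u G) P"
proof -
  have V: "u \<in> verts G" "v \<in> verts G" using wf_edgeD assms by metis+
  have "marked_iso (merge v u) (contract_edge u v G) (contract_edge v u G)"
    unfolding marked_iso_def
  proof (intro conjI ballI)
    show "inj_on (merge v u) (verts (contract_edge u v G))"
      by (auto simp: inj_on_def merge_def contract_edge_def)
    show "verts (contract_edge v u G) = merge v u ` verts (contract_edge u v G)"
      using V assms(3) by (auto simp: merge_def contract_edge_def image_iff)
    have "merge v u ` merge u v ` e = merge v u ` e" for e
      using assms(3) by (auto simp: merge_def image_iff)
    then show "edges (contract_edge v u G) =
        image_mset (image (merge v u)) (edges (contract_edge u v G))"
      by (simp add: contract_edge_def multiset.map_comp comp_def insert_commute)
    show "marks (contract_edge v u G) (merge v u x) = marks (contract_edge u v G) x"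
      if "x \<in> verts (contract_edge u v G)" for x
      using that assms(3) by (auto simp: merge_def contract_edge_def dotsum_def)
  qed
  then show ?thesis by (rule M_value_iso [OF assms(4) wf_contract [OF assms(1-3)]])
qed

lemma delete_delete: "delete_edge e (delete_edge f G) = delete_edge f (delete_edge e G)"
  by (simp add: delete_edge_def add_mset_commute)

lemma delete_contract:
  assumes "{u, v} \<in># edges G" "e \<in># edges G" "e \<noteq> {u, v}"
  shows "delete_edge (merge u v ` e) (contract_edge u v G) = contract_edge u v (delete_edge e G)"
proof -
  have "{#e#} \<subseteq># edges G - {#{u, v}#}" using assms by (simp add: in_diff_count count_greater_zero_iff)
  then have "image_mset (image (merge u v)) (edges G - {#{u, v}#}) - {#merge u v ` e#} =
      image_mset (image (merge u v)) (edges G - {#{u, v}#} - {#e#})"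
    by (subst image_mset_Diff) simp_all
  then show ?thesis by (simp add: delete_edge_def contract_edge_def add_mset_commute)
qed

lemma contract_mem:
  assumes "e \<in># edges G" "e \<noteq> {u, v}"
  shows "merge u v ` e \<in># edges (contract_edge u v G)"
  using assms by (auto simp: contract_edge_def in_diff_count count_greater_zero_iff)

lemma delete_mem: "e \<in># edges G \<Longrightarrow> e \<noteq> f \<Longrightarrow> e \<in># edges (delete_edge f G)"
  by (simp add: delete_edge_def in_diff_count)

lemma edges_contract_contract:
  assumes "{u, v} \<in># edges G" "{a, b} \<in># edges G" "{a, b} \<noteq> {u, v}"
    and img: "merge u v ` {a, b} = {a, b}"
  shows "edges (contract_edge a b (contract_edge u v G)) =
    image_mset (image (merge a b \<circ> merge u v)) (edges G - {#{a, b}, {u, v}#})"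
proof -
  have "edges (contract_edge a b (contract_edge u v G)) =
      image_mset (image (merge a b)) (edges (delete_edge (merge u v ` {a, b}) (contract_edge u v G)))"
    unfolding img by (simp add: contract_edge_def delete_edge_def)
  also have "\<dots> = image_mset (image (merge a b)) (edges (contract_edge u v (delete_edge {a, b} G)))"
    by (simp only: delete_contract [OF assms(1-3)])
  finally show ?thesis
    by (simp add: contract_edge_def delete_edge_def multiset.map_comp comp_def image_image add_mset_commute)
qed

lemma contract_contract:
  assumes "{u, v} \<in># edges G" "{a, b} \<in># edges G" "{a, b} \<noteq> {u, v}"
    and "merge u v ` {a, b} = {a, b}" "merge a b ` {u, v} = {u, v}"
    and "merge a b \<circ> merge u v = merge u v \<circ> merge a b"
    and "marks (contract_edge a b (contract_edge u v G)) = marks (contract_edge u v (contract_edge a b G))"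
  shows "contract_edge a b (contract_edge u v G) = contract_edge u v (contract_edge a b G)"
proof -
  have "edges (contract_edge a b (contract_edge u v G)) = edges (contract_edge u v (contract_edge a b G))"
    using edges_contract_contract [OF assms(1-4)]
      edges_contract_contract [OF assms(2,1) assms(3) [symmetric] assms(5)] assms(6)
    by (simp add: add_mset_commute)
  moreover have "verts (contract_edge a b (contract_edge u v G)) =
      verts (contract_edge u v (contract_edge a b G))"
    by (auto simp: contract_edge_def)
  ultimately show ?thesis using assms(7) by (simp add: marked_graph.equality)
qed

lemma contract_contract_disjoint:
  assumes "{u, v} \<in># edges G" "{a, b} \<in># edges G" "{u, v} \<inter> {a, b} = {}"
  shows "contract_edge a b (contract_edge u v G) = contract_edge u v (contract_edge a b G)"
proof -
  have ne: "u \<noteq> a" "u \<noteq> b" "v \<noteq> a" "v \<noteq> b" using assms(3) by auto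
  show ?thesis
    by (rule contract_contract [OF assms(1,2)])
      (use ne in \<open>auto simp: merge_def fun_eq_iff contract_edge_def doubleton_eq_iff\<close>)
qed

lemma contract_contract_shared:
  assumes "{u, v} \<in># edges G" "{u, b} \<in># edges G" "u \<noteq> v" "u \<noteq> b" "v \<noteq> b"
  shows "contract_edge u b (contract_edge u v G) = contract_edge u v (contract_edge u b G)"
  by (rule contract_contract [OF assms(1,2)])
    (use assms(3-5) in \<open>auto simp: merge_def fun_eq_iff contract_edge_def doubleton_eq_iff dotsum_def\<close>)

lemma M_value_unique:
  "wf_marked G \<Longrightarrow> M_value G P \<Longrightarrow> M_value G Q \<Longrightarrow> P = Q"
proof (induction "size (edges G)" arbitrary: G P Q rule: less_induct)
  case less
  note wf = less.prems(1)
  have uniq_del: "A = B" if "e \<in># edges G" "M_value (delete_edge e G) A"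
    "M_value (delete_edge e G) B" for e A B
    by (rule less.hyps [OF size_delete [OF that(1)] wf_delete [OF wf] that(2,3)])
  have uniq_con: "A = B" if "{u, v} \<in># edges G" "u \<noteq> v" "M_value (contract_edge u v G) A"
    "M_value (contract_edge u v G) B" for u v A B
    by (rule less.hyps [OF size_contract [OF that(1)] wf_contract [OF wf that(1,2)] that(3,4)])

  have loops: "var Y * A = var Y * B"
    if v: "{v} \<in># edges G" "M_value (delete_edge {v} G) A"
      and w: "{w} \<in># edges G" "M_value (delete_edge {w} G) B" for v w A B
  proof (cases "v = w")
    case True
    then show ?thesis using uniq_del [OF v] w by simp
  next
    case False
    have wf2: "wf_marked (delete_edge {w} (delete_edge {v} G))" using wf wf_delete by blast
    then obtain R where R: "M_value (delete_edge {w} (delete_edge {v} G)) R"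
      using M_value_exists by blast
    have R': "M_value (delete_edge {v} (delete_edge {w} G)) R"
      using R by (simp only: delete_delete [of "{v}"])
    have mem: "{w} \<in># edges (delete_edge {v} G)" "{v} \<in># edges (delete_edge {w} G)"
      using v w False delete_mem by (metis singleton_inject)+
    have "M_value (delete_edge {v} G) (var Y * R)" "M_value (delete_edge {w} G) (var Y * R)"
      using M_value.loop [OF mem(1) R] M_value.loop [OF mem(2) R'] .
    then have "A = var Y * R" "B = var Y * R"
      using uniq_del [OF v] uniq_del [OF w] by simp_all
    then show ?thesis by simp
  qed

  have mixed: "var Y * A = B + C"
    if w: "{w} \<in># edges G" "M_value (delete_edge {w} G) A"
      and uv: "{u, v} \<in># edges G" "u \<noteq> v" "M_value (delete_edge {u, v} G) B"
        "M_value (contract_edge u v G) C" for w u v A B C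
  proof -
    have ne: "{w} \<noteq> {u, v}" using uv by auto
    have m1: "{u, v} \<in># edges (delete_edge {w} G)" "{w} \<in># edges (delete_edge {u, v} G)"
      using delete_mem ne w uv by metis+
    have m2: "{merge u v w} \<in># edges (contract_edge u v G)"
      using contract_mem [OF w(1) ne] by simp
    obtain R where R: "M_value (delete_edge {w} (delete_edge {u, v} G)) R"
      using M_value_exists [OF wf_delete [OF wf_delete [OF wf]]] ..
    obtain S where S: "M_value (contract_edge u v (delete_edge {w} G)) S"
      using M_value_exists [OF wf_contract [OF wf_delete [OF wf] m1(1) uv(2)]] ..
    have "M_value (delete_edge {w} G) (R + S)"
      using M_value.nonloop [OF m1(1) uv(2) _ S] R by (simp only: delete_delete [of "{w}"])
    then have "A = R + S" by (rule uniq_del [OF w])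
    moreover have "B = var Y * R" by (rule uniq_del [OF uv(1,3) M_value.loop [OF m1(2) R]])
    moreover have "M_value (delete_edge {merge u v w} (contract_edge u v G)) S"
      using S delete_contract [OF uv(1) w(1) ne] by simp
    then have "C = var Y * S" by (rule uniq_con [OF uv(1,2,4) M_value.loop [OF m2]])
    ultimately show ?thesis by (simp add: algebra_simps)
  qed

  have nonloops: "A + B = C + D"
    if uv: "{u, v} \<in># edges G" "u \<noteq> v" "M_value (delete_edge {u, v} G) A"
        "M_value (contract_edge u v G) B"
      and ab: "{a, b} \<in># edges G" "a \<noteq> b" "M_value (delete_edge {a, b} G) C"
        "M_value (contract_edge a b G) D"
      and ne: "{u, v} \<noteq> {a, b}"
      and img: "merge u v ` {a, b} = {a, b}" "merge a b ` {u, v} = {u, v}"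
      and comm: "contract_edge a b (contract_edge u v G) = contract_edge u v (contract_edge a b G)"
    for u v a b A B C D
  proof -
    have m1: "{u, v} \<in># edges (delete_edge {a, b} G)" "{a, b} \<in># edges (delete_edge {u, v} G)"
      using delete_mem ne ab uv by metis+
    have m2: "{a, b} \<in># edges (contract_edge u v G)"
      using contract_mem [OF ab(1) ne [symmetric]] by (simp only: img)
    have m3: "{u, v} \<in># edges (contract_edge a b G)"
      using contract_mem [OF uv(1) ne] by (simp only: img)
    obtain R where R: "M_value (delete_edge {a, b} (delete_edge {u, v} G)) R"
      using M_value_exists [OF wf_delete [OF wf_delete [OF wf]]] ..
    obtain S where S: "M_value (contract_edge u v (delete_edge {a, b} G)) S"
      using M_value_exists [OF wf_contract [OF wf_delete [OF wf] m1(1) uv(2)]] ..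
    obtain T where T: "M_value (contract_edge a b (delete_edge {u, v} G)) T"
      using M_value_exists [OF wf_contract [OF wf_delete [OF wf] m1(2) ab(2)]] ..
    obtain U where U: "M_value (contract_edge a b (contract_edge u v G)) U"
      using M_value_exists [OF wf_contract [OF wf_contract [OF wf uv(1,2)] m2 ab(2)]] ..
    have "A = R + T" by (rule uniq_del [OF uv(1,3) M_value.nonloop [OF m1(2) ab(2) R T]])
    moreover have "C = R + S"
      using uniq_del [OF ab(1,3) M_value.nonloop [OF m1(1) uv(2) _ S]] R
      by (simp only: delete_delete [of "{a, b}"])
    moreover have "M_value (delete_edge {a, b} (contract_edge u v G)) S"
      using delete_contract [OF uv(1) ab(1) ne [symmetric]] S by (simp only: img)
    then have "B = S + U"
      by (rule uniq_con [OF uv(1,2,4) M_value.nonloop [OF m2 ab(2) _ U]])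
    moreover have "M_value (delete_edge {u, v} (contract_edge a b G)) T"
      using delete_contract [OF ab(1) uv(1) ne] T by (simp only: img)
    then have "D = T + U"
      by (rule uniq_con [OF ab(1,2,4) M_value.nonloop [OF m3 uv(2) _ U [unfolded comm]]])
    ultimately show ?thesis by simp
  qed

  have shared: "A + B = C + D"
    if uv: "{u, v} \<in># edges G" "u \<noteq> v" "M_value (delete_edge {u, v} G) A"
        "M_value (contract_edge u v G) B"
      and ab: "{u, b} \<in># edges G" "u \<noteq> b" "M_value (delete_edge {u, b} G) C"
        "M_value (contract_edge u b G) D"
    for u v b A B C D
  proof (cases "v = b")
    case True
    then show ?thesis using uniq_del [OF uv(1,3)] uniq_con [OF uv(1,2,4)] ab by simp
  next
    case False
    show ?thesis
    proof (rule nonloops [OF uv ab])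
      show "{u, v} \<noteq> {u, b}" using False uv by (auto simp: doubleton_eq_iff)
      show "merge u v ` {u, b} = {u, b}" "merge u b ` {u, v} = {u, v}"
        using False uv ab by (auto simp: merge_def)
      show "contract_edge u b (contract_edge u v G) = contract_edge u v (contract_edge u b G)"
        by (rule contract_contract_shared [OF uv(1) ab(1) uv(2) ab(2) False])
    qed
  qed

  have nonloop_all: "A + B = C + D"
    if uv: "{u, v} \<in># edges G" "u \<noteq> v" "M_value (delete_edge {u, v} G) A"
        "M_value (contract_edge u v G) B"
      and ab: "{a, b} \<in># edges G" "a \<noteq> b" "M_value (delete_edge {a, b} G) C"
        "M_value (contract_edge a b G) D"
    for u v a b A B C D
  proof -
    have vu: "{v, u} \<in># edges G" "v \<noteq> u" "M_value (delete_edge {v, u} G) A"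
        "M_value (contract_edge v u G) B"
      using uv M_value_contract_swap [OF wf uv(1,2,4)] by (auto simp: insert_commute)
    have ba: "{b, a} \<in># edges G" "b \<noteq> a" "M_value (delete_edge {b, a} G) C"
        "M_value (contract_edge b a G) D"
      using ab M_value_contract_swap [OF wf ab(1,2,4)] by (auto simp: insert_commute)
    consider "u = a" | "u = b" | "v = a" | "v = b" | "{u, v} \<inter> {a, b} = {}" by blast
    then show ?thesis
    proof cases
      case 1 then show ?thesis using shared [OF uv] ab by simp
    next
      case 2 then show ?thesis using shared [OF uv] ba by simp
    next
      case 3 then show ?thesis using shared [OF vu] ab by simp
    next
      case 4 then show ?thesis using shared [OF vu] ba by simp
    next
      case 5
      show ?thesis
      proof (rule nonloops [OF uv ab])
        show "{u, v} \<noteq> {a, b}" using 5 by auto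
        show "merge u v ` {a, b} = {a, b}" "merge a b ` {u, v} = {u, v}"
          using 5 by (auto simp: merge_def)
        show "contract_edge a b (contract_edge u v G) = contract_edge u v (contract_edge a b G)"
          by (rule contract_contract_disjoint [OF uv(1) ab(1) 5])
      qed
    qed
  qed

  from less.prems(2) show ?case
  proof cases
    case P: edgeless
    from less.prems(3) show ?thesis by cases (use P in auto)
  next
    case P: (loop v A)
    from less.prems(3) show ?thesis
    proof cases
      case edgeless then show ?thesis using P by auto
    next
      case (loop w B) then show ?thesis using P loops by metis
    next
      case (nonloop u v B C) then show ?thesis using P mixed by metis
    qed
  next
    case P: (nonloop u v A B)
    from less.prems(3) show ?thesis
    proof cases
      case edgeless then show ?thesis using P by auto
    next
      case (loop w C) then show ?thesis using P mixed by metis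
    next
      case (nonloop a b C D)
      then show ?thesis using P nonloop_all by metis
    qed
  qed
qed

lemma M_value_M_poly: "wf_marked G \<Longrightarrow> M_value G (M_poly G)"
  unfolding M_poly_def using M_value_exists M_value_unique by (metis theI')

lemma M_poly_eqI: "wf_marked G \<Longrightarrow> M_value G P \<Longrightarrow> M_poly G = P"
  using M_value_M_poly M_value_unique by blast

lemma M_poly_edgeless:
  "wf_marked G \<Longrightarrow> edges G = {#} \<Longrightarrow>
    M_poly G = (\<Prod>v\<in>verts G. var (Z (fst (marks G v)) (snd (marks G v))))"
  by (rule M_poly_eqI) (auto intro: M_value.edgeless)

lemma M_poly_loop:
  "wf_marked G \<Longrightarrow> {v} \<in># edges G \<Longrightarrow> M_poly G = var Y * M_poly (delete_edge {v} G)"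
  by (rule M_poly_eqI) (auto intro: M_value.loop M_value_M_poly wf_delete)

lemma M_poly_nonloop:
  "wf_marked G \<Longrightarrow> {u, v} \<in># edges G \<Longrightarrow> u \<noteq> v \<Longrightarrow>
    M_poly G = M_poly (delete_edge {u, v} G) + M_poly (contract_edge u v G)"
  by (rule M_poly_eqI) (auto intro: M_value.nonloop M_value_M_poly wf_delete wf_contract)

section \<open>Absorption and cores\<close>

text \<open>A loop contributes two to the degree of its vertex.\<close>

definition degree :: "'a marked_graph \<Rightarrow> 'a \<Rightarrow> nat" where
  "degree G v = size {#e \<in># edges G. v \<in> e#} + count (edges G) {v}"

definition absorbable_vertex :: "'a marked_graph \<Rightarrow> 'a \<Rightarrow> bool" where
  "absorbable_vertex G v \<longleftrightarrow> v \<in> verts G \<and> degree G v = 1 \<and> marks G v = (1, 0)"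

definition absorbable_edge :: "'a marked_graph \<Rightarrow> 'a set \<Rightarrow> bool" where
  "absorbable_edge G e \<longleftrightarrow> e \<in># edges G \<and> (\<exists>v\<in>e. absorbable_vertex G v)"

definition absorb_edge :: "'a \<Rightarrow> 'a \<Rightarrow> 'a marked_graph \<Rightarrow> 'a marked_graph" where
  "absorb_edge u v G =
     (contract_edge u v G)\<lparr>marks := (marks G)(u := (fst (marks G u) + 1, snd (marks G u)))\<rparr>"

inductive absorb_step :: "'a marked_graph \<Rightarrow> 'a marked_graph \<Rightarrow> bool" where
  "{u, v} \<in># edges G \<Longrightarrow> absorbable_vertex G v \<Longrightarrow> absorb_step G (absorb_edge u v G)"

text \<open>
  \<open>is_core_of K G\<close> means that \<^term>\<open>K\<close> results from \<^term>\<open>G\<close> by some exhaustive sequence of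
  absorptions. Different sequences can only lead to different names of the remaining vertices.
\<close>

definition is_core_of :: "'a marked_graph \<Rightarrow> 'a marked_graph \<Rightarrow> bool" where
  "is_core_of K G \<longleftrightarrow> absorb_step\<^sup>*\<^sup>* G K \<and> (\<nexists>e. absorbable_edge K e)"

lemma wf_unit_marked:
  assumes "simple_graph V E"
  shows "wf_marked (unit_marked V E)"
proof -
  have "E \<subseteq> Pow V" using assms by (auto simp: simple_graph_def)
  then have "finite E" using assms finite_subset by (auto simp: simple_graph_def)
  then show ?thesis
    using assms
    by (fastforce simp: wf_marked_def unit_marked_def simple_graph_def valid_mark_def card_2_iff)
qed

lemma absorbable_neighbour:
  assumes "absorbable_vertex G v" "{u, v} \<in># edges G"
  shows "u \<noteq> v"
proof
  assume "u = v"
  then have v: "{v} \<in># edges G" using assms by simp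
  then have "{v} \<in># {#e \<in># edges G. v \<in> e#}" by simp
  then have "size {#e \<in># edges G. v \<in> e#} > 0" by (metis nonempty_has_size empty_not_add_mset multi_member_split)
  moreover have "count (edges G) {v} > 0" using v by simp
  ultimately have "degree G v \<ge> 2" unfolding degree_def by linarith
  then show False using assms by (simp add: absorbable_vertex_def)
qed

lemma wf_absorb_step:
  assumes "absorb_step G H" "wf_marked G"
  shows "wf_marked H"
  using assms
proof cases
  case (1 u v)
  then have uv: "u \<noteq> v" using absorbable_neighbour by metis
  then have "wf_marked (contract_edge u v G)" using 1 assms wf_contract by metis
  moreover have "u \<in> verts G" using wf_edgeD 1 assms by metis
  ultimately show ?thesis using 1 assms(2)
    by (auto simp: wf_marked_def absorb_edge_def contract_edge_def valid_mark_def)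
qed

lemma core_exists: "wf_marked G \<Longrightarrow> \<exists>K. is_core_of K G"
proof (induction "size (edges G)" arbitrary: G rule: less_induct)
  case less
  show ?case
  proof (cases "\<exists>e. absorbable_edge G e")
    case False
    then show ?thesis by (auto simp: is_core_of_def)
  next
    case True
    then obtain e v where e: "e \<in># edges G" "v \<in> e" "absorbable_vertex G v"
      by (auto simp: absorbable_edge_def)
    obtain a b where "e = {a, b}" using wf_edgeE [OF less.prems e(1)] by metis
    then obtain u where u: "e = {u, v}" using e(2) by auto
    then have step: "absorb_step G (absorb_edge u v G)"
      using e absorb_step.intros by metis
    have "size (edges (absorb_edge u v G)) < size (edges G)"
      using size_contract [of u v G] e u by (simp add: absorb_edge_def)
    then obtain K where "is_core_of K (absorb_edge u v G)"
      using less wf_absorb_step step by blast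
    then show ?thesis using step by (auto simp: is_core_of_def intro: converse_rtranclp_into_rtranclp)
  qed
qed

end

theory Submission
  imports Defs
begin

text \<open>
  Write \<open>p = \<Sum>\<^sub>c x\<^sub>c\<close>. Since \<open>\<ss>\<tt>\<^sub>w = \<Sum>\<^sub>c x\<^sub>c (p - x\<^sub>c)\<^bsup>w-1\<^esup>\<close>, the binomial theorem shows that the
  substitution turns \<open>D\<^bsub>w,d\<^esub>\<close> into \<open>\<Sum>\<^sub>c x\<^sub>c (- x\<^sub>c)\<^bsup>d\<^esup> (p - x\<^sub>c)\<^bsup>w-1-d\<^esup>\<close>. Weight a vertex with mark
  \<open>(w, d)\<close> and colour \<open>c\<close> by this summand. The weight of a dot-sum is minus the product of the
  weights, so the weighted count of proper colourings of a marked graph satisfies the recursion of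
  \<open>M\<close> at \<open>y = 0\<close>. It is invariant under absorption, because the colour of an absorbed leaf ranges
  over all colours except that of its neighbour, which contributes the factor \<open>p - x\<^sub>c\<close>. For the
  marks \<open>(1, 0)\<close> it is the chromatic symmetric function. To have finite sums only, all but finitely
  many variables are set to zero.
\<close>

section \<open>Ring homomorphisms\<close>

text \<open>Substitution and restriction of variables both have these properties, and so do their
  composites; the rules for sums, products and powers then serve all of them.\<close>

locale ring_map =
  fixes h :: "'r::comm_ring_1 \<Rightarrow> 's::comm_ring_1"
  assumes map_one: "h 1 = 1"
    and map_add: "h (a + b) = h a + h b"
    and map_mult: "h (a * b) = h a * h b"
begin

lemma map_zero: "h 0 = 0"
  using map_add [of 0 0] by simp

lemma map_uminus: "h (- a) = - h a"
  using map_add [of a "- a"] by (simp add: map_zero eq_neg_iff_add_eq_0 add.commute)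

lemma map_power: "h (a ^ n) = h a ^ n"
  by (induction n) (simp_all add: map_one map_mult)

lemma map_of_nat: "h (of_nat n) = of_nat n"
  by (induction n) (simp_all add: map_zero map_one map_add)

lemma map_sum: "h (sum f A) = (\<Sum>a\<in>A. h (f a))"
  by (induction A rule: infinite_finite_induct) (simp_all add: map_zero map_add)

lemma map_prod: "h (prod f A) = (\<Prod>a\<in>A. h (f a))"
  by (induction A rule: infinite_finite_induct) (simp_all add: map_one map_mult)

end

lemma ring_map_comp:
  assumes "ring_map f" "ring_map g"
  shows "ring_map (\<lambda>a. g (f a))"
  using assms by (simp add: ring_map_def)

subsection \<open>Substitution into polynomials\<close>

lemma subst_poly_add: "subst_poly \<sigma> (p + q) = subst_poly \<sigma> p + subst_poly \<sigma> q"
  unfolding subst_poly_def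
  by (rule setsum_keys_plus_distrib) (simp_all add: distrib_right)

lemma subst_poly_single:
  "subst_poly \<sigma> (Poly_Mapping.single A a) = of_int a * (\<Prod>x\<in>#A. \<sigma> x)"
  by (cases "a = 0") (simp_all add: subst_poly_def)

lemma subst_poly_var: "subst_poly \<sigma> (var x) = \<sigma> x"
  by (simp add: var_def subst_poly_single)

text \<open>Turns \<open>update_induct\<close> into an induction over sums of monomials, to which
  additivity of \<open>subst_poly\<close> applies.\<close>

lemma update_eq_single_add:
  assumes "a \<notin> Poly_Mapping.keys f"
  shows "Poly_Mapping.update a b f = Poly_Mapping.single a b + f"
  using assms
  by (intro poly_mapping_eqI)
    (auto simp: lookup_update lookup_add lookup_single in_keys_iff when_def)

text \<open>Multiplicativity follows by linearity in each factor. This is the induction on the right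
  factor; \<open>subst_poly_mult\<close> does the left one.\<close>

lemma subst_poly_single_mult:
  "subst_poly \<sigma> (Poly_Mapping.single A a * q) =
    subst_poly \<sigma> (Poly_Mapping.single A a) * subst_poly \<sigma> q"
proof (induction q rule: update_induct)
  case const
  show ?case by (simp add: subst_poly_def)
next
  case (update f B b)
  then show ?case
    by (simp add: update_eq_single_add distrib_left subst_poly_add mult_single subst_poly_single
        mult_ac)
qed

lemma subst_poly_mult: "subst_poly \<sigma> (p * q) = subst_poly \<sigma> p * subst_poly \<sigma> q"
proof (induction p rule: update_induct)
  case const
  show ?case by (simp add: subst_poly_def)
next
  case (update f B b)
  then show ?case
    by (simp add: update_eq_single_add distrib_right subst_poly_add subst_poly_single_mult)
qed

lemma ring_map_subst_poly: "ring_map (subst_poly \<sigma>)"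
proof
  have "subst_poly \<sigma> (Poly_Mapping.single {#} 1) = 1" by (simp only: subst_poly_single) simp
  then show "subst_poly \<sigma> 1 = 1" by (simp flip: zero_multiset_def)
qed (rule subst_poly_add subst_poly_mult)+

subsection \<open>Restriction to finitely many variables\<close>

text \<open>This is the substitution of 0 for all variables outside \<open>C\<close>: a monomial
  that contains one of them vanishes.\<close>

definition restrict_vars :: "'x set \<Rightarrow> ('x, 'c::comm_ring_1) mpser \<Rightarrow> ('x, 'c) mpser" where
  "restrict_vars C f = Abs_mpser (\<lambda>A. if set_mset A \<subseteq> C then mcoeff f A else 0)"

text \<open>Multiplicativity holds because two complementary submultisets of \<open>A\<close> have
  support in \<open>C\<close> exactly when \<open>A\<close> has.\<close>

lemma ring_map_restrict_vars: "ring_map (restrict_vars C)"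
proof
  show "restrict_vars C 1 = 1"
    by (rule mpser_eqI) (simp add: restrict_vars_def one_mpser_def)
  show "restrict_vars C (f + g) = restrict_vars C f + restrict_vars C g" for f g :: "('a, 'b) mpser"
    by (rule mpser_eqI) (simp add: restrict_vars_def plus_mpser_def)
  show "restrict_vars C (f * g) = restrict_vars C f * restrict_vars C g" for f g :: "('a, 'b) mpser"
  proof (rule mpser_eqI)
    fix A :: "'a multiset"
    have supp: "set_mset B \<subseteq> C \<and> set_mset (A - B) \<subseteq> C \<longleftrightarrow> set_mset A \<subseteq> C" if "B \<subseteq># A" for B
      using that by (metis set_mset_union subset_mset.add_diff_inverse Un_subset_iff)
    have "(if set_mset A \<subseteq> C then \<Sum>B | B \<subseteq># A. mcoeff f B * mcoeff g (A - B) else 0) =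
      (\<Sum>B | B \<subseteq># A. (if set_mset B \<subseteq> C then mcoeff f B else 0) *
        (if set_mset (A - B) \<subseteq> C then mcoeff g (A - B) else 0))"
    proof (cases "set_mset A \<subseteq> C")
      case True
      then show ?thesis using supp by (auto intro!: sum.cong)
    next
      case False
      then have "\<forall>B. B \<subseteq># A \<longrightarrow> \<not> set_mset B \<subseteq> C \<or> \<not> set_mset (A - B) \<subseteq> C"
        using supp by blast
      then show ?thesis
        using False by (intro trans [OF if_not_P sum.neutral [symmetric]]) auto
    qed
    then show "mcoeff (restrict_vars C (f * g)) A = mcoeff (restrict_vars C f * restrict_vars C g) A"
      by (simp only: restrict_vars_def times_mpser_def Abs_mpser_inverse [OF UNIV_I])
  qed
qed

text \<open>A monomial contains finitely many variables, so its coefficient survives the restriction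
  to \<open>set_mset A\<close>.\<close>

lemma mpser_eq_restrictI:
  assumes "\<And>C. finite C \<Longrightarrow> restrict_vars C f = restrict_vars C g"
  shows "f = g"
proof (rule mpser_eqI)
  fix A
  show "mcoeff f A = mcoeff g A"
    using arg_cong [OF assms [of "set_mset A"], of "\<lambda>f. mcoeff f A"] by (simp add: restrict_vars_def)
qed

section \<open>Monomials as power series\<close>

definition mmonom :: "'x multiset \<Rightarrow> ('x, 'c::comm_ring_1) mpser" where
  "mmonom A = Abs_mpser (\<lambda>B. if B = A then 1 else 0)"

lemma mmonom_mult: "mmonom A * mmonom B = (mmonom (A + B) :: ('x, 'c::comm_ring_1) mpser)"
proof (rule mpser_eqI)
  fix M :: "'x multiset"
  have "(\<Sum>D | D \<subseteq># M. (if D = A then 1 else 0) * (if M - D = B then 1 else 0)) =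
    (\<Sum>D | D \<subseteq># M. if D = A then (if M - A = B then 1 else 0) else (0::'c))"
    by (rule sum.cong) auto
  \<comment> \<open>Multiset difference truncates, so \<open>M - A = B\<close> yields
    \<open>M = A + B\<close> only together with the range condition on \<open>D = A\<close>.\<close>
  also have "\<dots> = (if M = A + B then 1 else 0)"
    by (auto simp: sum.delta)
  finally show "mcoeff (mmonom A * mmonom B) M = mcoeff (mmonom (A + B) :: ('x, 'c) mpser) M"
    by (simp add: mmonom_def times_mpser_def)
qed

lemma prod_mmonom:
  assumes "finite V"
  shows "(\<Prod>v\<in>V. mmonom {#\<kappa> v#}) = mmonom (image_mset \<kappa> (mset_set V))"
  using assms
proof (induction V rule: finite_induct)
  case empty
  show ?case by (simp add: mmonom_def one_mpser_def)
qed (simp add: mmonom_mult)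

lemma mcoeff_sum: "mcoeff (sum f I) A = (\<Sum>i\<in>I. mcoeff (f i) A)"
  by (induction I rule: infinite_finite_induct) (simp_all add: zero_mpser_def plus_mpser_def)

section \<open>Weighted counts of proper colourings\<close>

definition mark_weight :: "('c \<Rightarrow> 'r::comm_ring_1) \<Rightarrow> 'c set \<Rightarrow> mark \<Rightarrow> 'c \<Rightarrow> 'r" where
  "mark_weight x C a c = x c * (- x c) ^ snd a * (sum x C - x c) ^ (fst a - 1 - snd a)"

text \<open>An edge is properly coloured iff its image has two elements; this rules out loops.\<close>

definition proper_on :: "'a set multiset \<Rightarrow> ('a \<Rightarrow> 'c) \<Rightarrow> bool" where
  "proper_on M \<kappa> \<longleftrightarrow> (\<forall>e\<in>#M. card (\<kappa> ` e) = 2)"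

text \<open>Improper colourings stay in the index set with summand 0, so a change of edges leaves
  the domain of summation alone.\<close>

definition weighted_count :: "('c \<Rightarrow> 'r::comm_ring_1) \<Rightarrow> 'c set \<Rightarrow> 'a marked_graph \<Rightarrow> 'r" where
  "weighted_count x C G =
    (\<Sum>\<kappa>\<in>verts G \<rightarrow>\<^sub>E C. if proper_on (edges G) \<kappa>
       then \<Prod>v\<in>verts G. mark_weight x C (marks G v) (\<kappa> v) else 0)"

lemma mark_weight_unit: "mark_weight x C (1, 0) c = x c"
  by (simp add: mark_weight_def)

text \<open>One of the two leading factors \<open>x c\<close> turns into the additional factor
  \<open>- x c\<close>, whence the sign. For valid marks the last exponents add without
  truncation.\<close>

lemma mark_weight_dotsum:
  assumes "valid_mark a" "valid_mark b"
  shows "mark_weight x C (dotsum a b) c = - (mark_weight x C a c * mark_weight x C b c)"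
proof -
  have "fst a + fst b - 1 - (snd a + snd b + 1) = (fst a - 1 - snd a) + (fst b - 1 - snd b)"
    using assms by (simp add: valid_mark_def)
  then show ?thesis
    by (simp add: mark_weight_def dotsum_def power_add mult_ac)
qed

lemma mark_weight_absorb:
  assumes "valid_mark a"
  shows "mark_weight x C (fst a + 1, snd a) c = mark_weight x C a c * (sum x C - x c)"
proof -
  have "fst a + 1 - 1 - snd a = Suc (fst a - 1 - snd a)"
    using assms unfolding valid_mark_def by linarith
  then show ?thesis by (simp add: mark_weight_def mult_ac)
qed

section \<open>Separating the colour of one vertex\<close>

lemma sum_PiE_insert:
  assumes "v \<notin> V" "finite V" "finite C"
  shows "(\<Sum>\<kappa>\<in>insert v V \<rightarrow>\<^sub>E C. f \<kappa>) = (\<Sum>\<kappa>\<in>V \<rightarrow>\<^sub>E C. \<Sum>c\<in>C. f (\<kappa>(v := c)))"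
proof -
  have "(\<Sum>\<kappa>\<in>insert v V \<rightarrow>\<^sub>E C. f \<kappa>) = (\<Sum>(c, \<kappa>)\<in>C \<times> (V \<rightarrow>\<^sub>E C). f (\<kappa>(v := c)))"
    unfolding PiE_insert_eq
    by (subst sum.reindex [OF inj_combinator [OF assms(1)]]) (simp add: case_prod_beta)
  also have "\<dots> = (\<Sum>c\<in>C. \<Sum>\<kappa>\<in>V \<rightarrow>\<^sub>E C. f (\<kappa>(v := c)))"
    by (simp add: sum.cartesian_product)
  also have "\<dots> = (\<Sum>\<kappa>\<in>V \<rightarrow>\<^sub>E C. \<Sum>c\<in>C. f (\<kappa>(v := c)))"
    by (rule sum.swap)
  finally show ?thesis .
qed

text \<open>Contraction and absorption remove \<open>v\<close>. To compare counts before and after,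
  the sum is arranged over colourings of the other vertices, with the colour of \<open>v\<close>
  innermost.\<close>

lemma weighted_count_split_vertex:
  assumes "finite (verts G)" "v \<in> verts G" "finite C"
  shows "weighted_count x C G =
    (\<Sum>\<kappa>\<in>verts G - {v} \<rightarrow>\<^sub>E C. \<Sum>c\<in>C. if proper_on (edges G) (\<kappa>(v := c))
       then mark_weight x C (marks G v) c *
         (\<Prod>w\<in>verts G - {v}. mark_weight x C (marks G w) (\<kappa> w)) else 0)"
proof -
  have V: "insert v (verts G - {v}) = verts G" using assms by auto
  have "(\<Prod>w\<in>verts G. mark_weight x C (marks G w) ((\<kappa>(v := c)) w)) =
    mark_weight x C (marks G v) c * (\<Prod>w\<in>verts G - {v}. mark_weight x C (marks G w) (\<kappa> w))"
    for \<kappa> c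
    using assms by (subst prod.remove [of _ v]) auto
  moreover have "weighted_count x C G =
    (\<Sum>\<kappa>\<in>verts G - {v} \<rightarrow>\<^sub>E C. \<Sum>c\<in>C. if proper_on (edges G) (\<kappa>(v := c))
       then \<Prod>w\<in>verts G. mark_weight x C (marks G w) ((\<kappa>(v := c)) w) else 0)"
    unfolding weighted_count_def using sum_PiE_insert [of v "verts G - {v}" C, unfolded V] assms
    by blast
  ultimately show ?thesis by (simp only:)
qed

text \<open>The case of a loop is included: for \<open>u = v\<close> both sides are false.\<close>

lemma proper_on_add_edge:
  "proper_on (add_mset {u, v} M) \<kappa> \<longleftrightarrow> \<kappa> u \<noteq> \<kappa> v \<and> proper_on M \<kappa>"
  by (auto simp: proper_on_def)

text \<open>Composing a colouring with \<open>merge u v\<close> amounts to giving \<open>v\<close>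
  the colour of \<open>u\<close>.\<close>

lemma proper_on_merge:
  "proper_on (image_mset (image (merge u v)) M) \<kappa> \<longleftrightarrow> proper_on M (\<kappa>(v := \<kappa> u))"
proof -
  have "\<kappa>(v := \<kappa> u) = \<kappa> \<circ> merge u v" by (auto simp: merge_def)
  then show ?thesis by (simp add: proper_on_def image_comp)
qed

section \<open>The recursion of \<open>M\<close> at \<open>y = 0\<close>\<close>

lemma weighted_count_edgeless:
  assumes "finite (verts G)" "finite C" "edges G = {#}"
  shows "weighted_count x C G = (\<Prod>v\<in>verts G. \<Sum>c\<in>C. mark_weight x C (marks G v) c)"
  using assms by (simp add: weighted_count_def proper_on_def prod_sum_PiE)

lemma weighted_count_loop:
  fixes G :: "'a marked_graph" and x :: "'c \<Rightarrow> 'r::comm_ring_1"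
  assumes "{v} \<in># edges G"
  shows "weighted_count x C G = 0"
proof -
  have "\<not> proper_on (edges G) \<kappa>" for \<kappa> :: "'a \<Rightarrow> 'c"
    using assms by (force simp: proper_on_def)
  then show ?thesis by (simp add: weighted_count_def)
qed

text \<open>Proper colourings of the graph without the edge are of two kinds. Those with different
  colours at \<open>u\<close> and \<open>v\<close> are counted by \<open>G\<close>. Those with equal
  colours are the colourings of the contraction, where the sign of the dot-sum makes them
  cancel.\<close>

lemma weighted_count_nonloop:
  assumes wf: "wf_marked G" and uv: "{u, v} \<in># edges G" "u \<noteq> v" and C: "finite C"
  shows "weighted_count x C G =
    weighted_count x C (delete_edge {u, v} G) + weighted_count x C (contract_edge u v G)"
proof -
  define M where "M = edges G - {#{u, v}#}"
  define U where "U = verts G - {v}"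
  define m where "m = marks G"
  \<comment> \<open>\<open>W\<close> keeps the original mark at \<open>u\<close>, so it is a common
    factor of the summands of all three graphs.\<close>
  define W where "W \<kappa> = (\<Prod>w\<in>U. mark_weight x C (m w) (\<kappa> w))" for \<kappa>
  have G: "edges G = add_mset {u, v} M" using uv by (simp add: M_def)
  have fin: "finite (verts G)" and u: "u \<in> U" and v: "v \<in> verts G"
    using wf wf_edgeD [OF wf uv(1)] uv by (auto simp: wf_marked_def U_def)
  have valid: "valid_mark (m u)" "valid_mark (m v)"
    using wf u v by (auto simp: wf_marked_def U_def m_def)
  have finU: "finite U" using fin by (simp add: U_def)
  have merged: "(\<Prod>w\<in>U. mark_weight x C ((m(u := dotsum (m u) (m v))) w) (\<kappa> w)) =
    - (mark_weight x C (m v) (\<kappa> u) * W \<kappa>)" for \<kappa>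
  proof -
    have "(\<Prod>w\<in>U - {u}. mark_weight x C ((m(u := dotsum (m u) (m v))) w) (\<kappa> w)) =
      (\<Prod>w\<in>U - {u}. mark_weight x C (m w) (\<kappa> w))"
      by (rule prod.cong) auto
    then show ?thesis
      unfolding W_def prod.remove [OF finU u]
      by (simp add: mark_weight_dotsum [OF valid] mult_ac)
  qed
  have con: "weighted_count x C (contract_edge u v G) =
    (\<Sum>\<kappa>\<in>U \<rightarrow>\<^sub>E C. if proper_on M (\<kappa>(v := \<kappa> u)) then - (mark_weight x C (m v) (\<kappa> u) * W \<kappa>) else 0)"
    unfolding weighted_count_def contract_edge_def
    by (simp add: proper_on_merge merged [simplified] flip: M_def U_def m_def cong: if_cong)
  have del: "weighted_count x C (delete_edge {u, v} G) =
    (\<Sum>\<kappa>\<in>U \<rightarrow>\<^sub>E C. \<Sum>c\<in>C. if proper_on M (\<kappa>(v := c)) then mark_weight x C (m v) c * W \<kappa> else 0)"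
    using weighted_count_split_vertex [of "delete_edge {u, v} G" v C x] fin v C
    by (simp add: delete_edge_def M_def U_def m_def W_def cong: if_cong)
  have inner: "(\<Sum>c\<in>C. if proper_on (edges G) (\<kappa>(v := c)) then mark_weight x C (m v) c * W \<kappa> else 0) =
    (\<Sum>c\<in>C. if proper_on M (\<kappa>(v := c)) then mark_weight x C (m v) c * W \<kappa> else 0) +
    (if proper_on M (\<kappa>(v := \<kappa> u)) then - (mark_weight x C (m v) (\<kappa> u) * W \<kappa>) else 0)"
    (is "_ = (\<Sum>c\<in>C. ?f c) + ?t") if "\<kappa> \<in> U \<rightarrow>\<^sub>E C" for \<kappa>
  proof -
    have \<kappa>u: "\<kappa> u \<in> C" using that u by auto
    have "(\<Sum>c\<in>C. if proper_on (edges G) (\<kappa>(v := c)) then mark_weight x C (m v) c * W \<kappa> else 0) =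
      (\<Sum>c\<in>C - {\<kappa> u}. ?f c)"
      unfolding G proper_on_add_edge using uv C by (intro sum.mono_neutral_cong_right) auto
    \<comment> \<open>The term at \<open>c = \<kappa> u\<close> is the negative of
      \<open>?t\<close>.\<close>
    moreover have "(\<Sum>c\<in>C. ?f c) = ?f (\<kappa> u) + (\<Sum>c\<in>C - {\<kappa> u}. ?f c)"
      by (rule sum.remove [OF C \<kappa>u])
    ultimately show ?thesis by simp
  qed
  have "weighted_count x C G =
    (\<Sum>\<kappa>\<in>U \<rightarrow>\<^sub>E C. \<Sum>c\<in>C. if proper_on (edges G) (\<kappa>(v := c)) then mark_weight x C (m v) c * W \<kappa> else 0)"
    using weighted_count_split_vertex [OF fin v C] by (simp add: U_def m_def W_def cong: if_cong)
  then show ?thesis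
    unfolding con del by (simp add: inner sum.distrib)
qed

section \<open>Invariance under absorption\<close>

lemma absorbable_other_edges:
  assumes "absorbable_vertex G v" "{u, v} \<in># edges G" "e \<in># edges G - {#{u, v}#}"
  shows "v \<notin> e"
proof
  assume v: "v \<in> e"
  obtain N where "edges G - {#{u, v}#} = add_mset e N"
    using multi_member_split [OF assms(3)] by blast
  then have "edges G = add_mset {u, v} (add_mset e N)" using assms(2) by (metis insert_DiffM)
  \<comment> \<open>The edges \<open>{u, v}\<close> and \<open>e\<close>, which may be parallel, are
    both counted at \<open>v\<close>.\<close>
  then have "size {#e \<in># edges G. v \<in> e#} \<ge> 2" using v by simp
  then show False using assms by (simp add: absorbable_vertex_def degree_def)
qed

text \<open>Given the other colours, the leaf \<open>v\<close> may take any colour except that of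
  \<open>u\<close>. These choices have total weight \<open>sum x C - x (\<kappa> u)\<close>, the
  factor by which the raised mark changes the weight of \<open>u\<close>.\<close>

lemma weighted_count_absorb_step:
  fixes G :: "'a marked_graph" and x :: "'c \<Rightarrow> 'r::comm_ring_1"
  assumes "absorb_step G H" and wf: "wf_marked G" and C: "finite C"
  shows "weighted_count x C H = weighted_count x C G"
  using assms(1)
proof cases
  case (1 u v)
  note H = 1(1) and uv = 1(2) and abs = 1(3)
  have neq: "u \<noteq> v" using absorbable_neighbour abs uv by metis
  define M where "M = edges G - {#{u, v}#}"
  define U where "U = verts G - {v}"
  define m where "m = marks G"
  define W where "W \<kappa> = (\<Prod>w\<in>U. mark_weight x C (m w) (\<kappa> w))" for \<kappa>
  have G: "edges G = add_mset {u, v} M" using uv by (simp add: M_def)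
  have fin: "finite (verts G)" and u: "u \<in> U" and v: "v \<in> verts G"
    using wf wf_edgeD [OF wf uv] neq by (auto simp: wf_marked_def U_def)
  have valid: "valid_mark (m u)"
    using wf u by (auto simp: wf_marked_def U_def m_def)
  have mv: "marks G v = (1, 0)" using abs by (simp add: absorbable_vertex_def)
  have finU: "finite U" using fin by (simp add: U_def)
  \<comment> \<open>No edge in \<open>M\<close> contains \<open>v\<close>, so its colour is
    irrelevant there, and contraction leaves properness on \<open>M\<close> unchanged.\<close>
  have proper: "proper_on M (\<kappa>(v := c)) \<longleftrightarrow> proper_on M \<kappa>" for \<kappa> :: "'a \<Rightarrow> 'c" and c
  proof -
    have "(\<kappa>(v := c)) ` e = \<kappa> ` e" if "e \<in># M" for e
      using absorbable_other_edges [OF abs uv] that by (force simp: M_def)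
    then show ?thesis by (simp add: proper_on_def)
  qed
  have merged: "(\<Prod>w\<in>U. mark_weight x C ((m(u := (fst (m u) + 1, snd (m u)))) w) (\<kappa> w)) =
    (sum x C - x (\<kappa> u)) * W \<kappa>" for \<kappa>
  proof -
    have "(\<Prod>w\<in>U - {u}. mark_weight x C ((m(u := (fst (m u) + 1, snd (m u)))) w) (\<kappa> w)) =
      (\<Prod>w\<in>U - {u}. mark_weight x C (m w) (\<kappa> w))"
      by (rule prod.cong) auto
    then show ?thesis
      unfolding W_def prod.remove [OF finU u]
      using mark_weight_absorb [OF valid, of x C] by (simp add: mult_ac)
  qed
  have WH: "weighted_count x C H =
    (\<Sum>\<kappa>\<in>U \<rightarrow>\<^sub>E C. if proper_on M \<kappa> then (sum x C - x (\<kappa> u)) * W \<kappa> else 0)"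
    unfolding weighted_count_def H absorb_edge_def contract_edge_def
    by (simp add: proper_on_merge proper merged [simplified] flip: M_def U_def m_def cong: if_cong)
  have inner: "(\<Sum>c\<in>C. if proper_on (edges G) (\<kappa>(v := c)) then x c * W \<kappa> else 0) =
    (if proper_on M \<kappa> then (sum x C - x (\<kappa> u)) * W \<kappa> else 0)" if "\<kappa> \<in> U \<rightarrow>\<^sub>E C" for \<kappa>
  proof -
    have \<kappa>u: "\<kappa> u \<in> C" using that u by auto
    have "(\<Sum>c\<in>C. if proper_on (edges G) (\<kappa>(v := c)) then x c * W \<kappa> else 0) =
      (\<Sum>c\<in>C - {\<kappa> u}. if proper_on M \<kappa> then x c * W \<kappa> else 0)"
      unfolding G proper_on_add_edge proper using neq C by (intro sum.mono_neutral_cong_right) auto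
    also have "\<dots> = (if proper_on M \<kappa> then sum x (C - {\<kappa> u}) * W \<kappa> else 0)"
      by (simp add: sum_distrib_right)
    also have "sum x (C - {\<kappa> u}) = sum x C - x (\<kappa> u)"
      using sum.remove [OF C \<kappa>u, of x] by simp
    finally show ?thesis .
  qed
  have "weighted_count x C G =
    (\<Sum>\<kappa>\<in>U \<rightarrow>\<^sub>E C. \<Sum>c\<in>C. if proper_on (edges G) (\<kappa>(v := c)) then x c * W \<kappa> else 0)"
    using weighted_count_split_vertex [OF fin v C, of x] mark_weight_unit [of x C]
    by (simp add: U_def m_def W_def mv cong: if_cong)
  then show ?thesis unfolding WH by (simp add: inner)
qed

lemma weighted_count_absorb_steps:
  assumes "absorb_step\<^sup>*\<^sup>* G H" "wf_marked G" "finite C"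
  shows "wf_marked H \<and> weighted_count x C H = weighted_count x C G"
  using assms
  by (induction rule: rtranclp_induct) (auto simp: wf_absorb_step weighted_count_absorb_step)

text \<open>Both sides follow the rules of \<open>M_value\<close>: products over isolated vertices,
  0 at a loop, a sum at any other edge. Deletion and contraction preserve \<open>wf_marked\<close>,
  so only valid marks get evaluated.\<close>

lemma weighted_count_M_value:
  assumes "ring_map h" "finite C" "h (var Y) = 0"
    and dot: "\<And>w d. valid_mark (w, d) \<Longrightarrow> h (var (Z w d)) = (\<Sum>c\<in>C. mark_weight x C (w, d) c)"
    and "M_value G P" "wf_marked G"
  shows "h P = weighted_count x C G"
  using assms(5,6)
proof induction
  case (edgeless G)
  interpret ring_map h by fact
  have "finite (verts G)" "\<forall>v\<in>verts G. valid_mark (marks G v)"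
    using edgeless by (auto simp: wf_marked_def)
  then show ?case
    using edgeless dot by (simp add: weighted_count_edgeless assms map_prod)
next
  case (loop v G P)
  interpret ring_map h by fact
  show ?case using loop by (simp add: weighted_count_loop map_mult assms)
next
  case (nonloop u v G P Q)
  interpret ring_map h by fact
  show ?case
    using nonloop by (simp add: weighted_count_nonloop [of G u v] map_add assms wf_delete wf_contract)
qed

section \<open>Chromatic symmetric functions in finitely many variables\<close>

lemma simple_graph_finite_edges: "simple_graph V E \<Longrightarrow> finite E"
  unfolding simple_graph_def by (meson Pow_iff finite_Pow_iff finite_subset subsetI)

lemma proper_colorings_eq:
  assumes "simple_graph V E"
  shows "proper_colorings V E = {\<kappa> \<in> V \<rightarrow>\<^sub>E {1..}. proper_on (mset_set E) \<kappa>}"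
proof -
  have "(\<forall>u v. {u, v} \<in> E \<longrightarrow> \<kappa> u \<noteq> \<kappa> v) \<longleftrightarrow> (\<forall>e\<in>E. card (\<kappa> ` e) = 2)" for \<kappa> :: "'a \<Rightarrow> nat"
  proof
    assume L: "\<forall>u v. {u, v} \<in> E \<longrightarrow> \<kappa> u \<noteq> \<kappa> v"
    show "\<forall>e\<in>E. card (\<kappa> ` e) = 2"
    proof
      fix e assume e: "e \<in> E"
      then obtain u v where "e = {u, v}"
        using assms by (auto simp: simple_graph_def card_2_iff)
      then show "card (\<kappa> ` e) = 2" using L e by simp
    qed
  qed force
  \<comment> \<open>Finiteness of \<open>E\<close> matters, as \<open>mset_set\<close> of an
    infinite set is empty.\<close>
  then show ?thesis
    using simple_graph_finite_edges [OF assms] by (simp add: proper_colorings_def proper_on_def)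
qed

text \<open>With unit marks a colouring has its monomial as weight, and that monomial lies over
  \<open>C\<close> exactly when all colours used do. The intersection with \<open>{1..}\<close>
  removes 0, which is no colour but may belong to \<open>C\<close>.\<close>

lemma restrict_vars_chrom_sym:
  assumes G: "simple_graph V E" and C: "finite C"
  shows "restrict_vars C (chrom_sym V E) =
    weighted_count (\<lambda>c. mmonom {#c#}) (C \<inter> {1..}) (unit_marked V E)"
proof (rule mpser_eqI)
  fix A
  let ?K = "{\<kappa> \<in> V \<rightarrow>\<^sub>E C \<inter> {1..}. proper_on (mset_set E) \<kappa>}"
  have V: "finite V" using G by (simp add: simple_graph_def)
  have fin: "finite (V \<rightarrow>\<^sub>E C \<inter> {1..})" using V C by (intro finite_PiE) auto
  have "weighted_count (\<lambda>c. mmonom {#c#}) (C \<inter> {1..}) (unit_marked V E) =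
    (\<Sum>\<kappa>\<in>?K. mmonom (image_mset \<kappa> (mset_set V)) :: (nat, int) mpser)"
    using fin mark_weight_unit [of "\<lambda>c. mmonom {#c#} :: (nat, int) mpser" "C \<inter> {1..}"]
    by (simp add: weighted_count_def unit_marked_def prod_mmonom [OF V] sum.inter_filter cong: if_cong)
  then have "mcoeff (weighted_count (\<lambda>c. mmonom {#c#}) (C \<inter> {1..}) (unit_marked V E)) A =
    (\<Sum>\<kappa>\<in>?K. if image_mset \<kappa> (mset_set V) = A then 1 else (0 :: int))"
    by (simp add: mcoeff_sum mmonom_def eq_commute)
  also have "\<dots> = int (card {\<kappa> \<in> ?K. image_mset \<kappa> (mset_set V) = A})"
    using fin by (simp flip: sum.inter_filter)
  also have "{\<kappa> \<in> ?K. image_mset \<kappa> (mset_set V) = A} =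
    (if set_mset A \<subseteq> C then {\<kappa> \<in> proper_colorings V E. image_mset \<kappa> (mset_set V) = A} else {})"
    using V by (auto simp: proper_colorings_eq [OF G] PiE_iff)
  finally show "mcoeff (restrict_vars C (chrom_sym V E)) A =
      mcoeff (weighted_count (\<lambda>c. mmonom {#c#}) (C \<inter> {1..}) (unit_marked V E)) A"
    by (simp add: restrict_vars_def chrom_sym_def)
qed

section \<open>Stars and the values of \<open>D_dot\<close>\<close>

lemma simple_graph_star: "simple_graph (star_verts w) (star_edges w)"
  by (auto simp: simple_graph_def star_verts_def star_edges_def)

text \<open>Once the centre 0 has colour \<open>c\<close>, the \<open>w - 1\<close> leaves are
  coloured independently with colours other than \<open>c\<close>. The centre exists because
  \<open>w \<ge> 1\<close>.\<close>

lemma weighted_count_star: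
  fixes x :: "'c \<Rightarrow> 'r::comm_ring_1"
  assumes C: "finite C" and w: "w \<ge> 1"
  shows "weighted_count x C (unit_marked (star_verts w) (star_edges w)) =
    (\<Sum>c\<in>C. x c * (sum x C - x c) ^ (w - 1))"
proof -
  let ?L = "{1..<w}"
  have V: "star_verts w = insert 0 ?L" using w by (auto simp: star_verts_def)
  have fin: "finite (star_edges w)" using simple_graph_finite_edges simple_graph_star by blast
  have edges: "star_edges w = (\<lambda>i. {0, i}) ` ?L" by (auto simp: star_edges_def)
  \<comment> \<open>Distributes the properness condition over the leaves, so that the sum over
    colourings becomes a product of sums.\<close>
  have prod_if: "(\<Prod>i\<in>?L. if P i then f i else 0) = (if \<forall>i\<in>?L. P i then prod f ?L else 0)"
    for P and f :: "nat \<Rightarrow> 'r"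
    by (auto intro!: prod_zero)
  have inner: "(if proper_on (mset_set (star_edges w)) (\<kappa>(0 := c))
      then \<Prod>v\<in>insert 0 ?L. x ((\<kappa>(0 := c)) v) else 0) =
    x c * (\<Prod>i\<in>?L. if \<kappa> i \<noteq> c then x (\<kappa> i) else 0)" for \<kappa> c
  proof -
    have "proper_on (mset_set (star_edges w)) (\<kappa>(0 := c)) \<longleftrightarrow> (\<forall>i\<in>?L. \<kappa> i \<noteq> c)"
      using fin by (auto simp: proper_on_def edges card_insert_if)
    then show ?thesis using prod_if [of "\<lambda>i. \<kappa> i \<noteq> c" "\<lambda>i. x (\<kappa> i)"] by auto
  qed
  have others: "(\<Sum>a\<in>C. if a \<noteq> c then x a else 0) = sum x C - x c" if "c \<in> C" for c
  proof -
    have "(\<Sum>a\<in>C. if a \<noteq> c then x a else 0) = sum x (C - {c})"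
      using C by (intro sum.mono_neutral_cong_right) auto
    then show ?thesis using sum.remove [OF C that, of x] by simp
  qed
  have "weighted_count x C (unit_marked (star_verts w) (star_edges w)) =
    (\<Sum>\<kappa>\<in>insert 0 ?L \<rightarrow>\<^sub>E C. if proper_on (mset_set (star_edges w)) \<kappa>
       then \<Prod>v\<in>insert 0 ?L. x (\<kappa> v) else 0)"
    using mark_weight_unit [of x C] by (simp add: weighted_count_def unit_marked_def V cong: if_cong)
  also have "\<dots> = (\<Sum>\<kappa>\<in>?L \<rightarrow>\<^sub>E C. \<Sum>c\<in>C. x c * (\<Prod>i\<in>?L. if \<kappa> i \<noteq> c then x (\<kappa> i) else 0))"
    by (subst sum_PiE_insert) (simp_all only: inner, simp_all add: C)
  also have "\<dots> = (\<Sum>c\<in>C. x c * (\<Sum>\<kappa>\<in>?L \<rightarrow>\<^sub>E C. \<Prod>i\<in>?L. if \<kappa> i \<noteq> c then x (\<kappa> i) else 0))"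
    by (subst sum.swap) (simp add: sum_distrib_left)
  also have "\<dots> = (\<Sum>c\<in>C. x c * (\<Prod>i\<in>?L. \<Sum>a\<in>C. if a \<noteq> c then x a else 0))"
    using prod_sum_PiE [of ?L "\<lambda>_. C" "\<lambda>_ a. if a \<noteq> c then x a else 0" for c] C by simp
  also have "\<dots> = (\<Sum>c\<in>C. x c * (sum x C - x c) ^ (w - 1))"
    by (rule sum.cong) (simp_all add: others)
  finally show ?thesis .
qed

text \<open>For each colour, \<open>x c * (sum x C - x c) ^ (w - 1 - d)\<close> factors out. What
  remains is the binomial expansion of the \<open>d\<close>-th power of
  \<open>- sum x C + (sum x C - x c)\<close>, that is, of \<open>- x c\<close>.\<close>

lemma sum_mark_weight:
  assumes "valid_mark (w, d)"
  shows "(\<Sum>i=0..d. (-1) ^ i * of_nat (d choose i) *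
      (\<Sum>c\<in>C. x c * (sum x C - x c) ^ (w - i - 1)) * sum x C ^ i) =
    (\<Sum>c\<in>C. mark_weight x C (w, d) c)"
proof -
  let ?p = "sum x C"
  have "(\<Sum>i\<le>d. (-1) ^ i * of_nat (d choose i) * (x c * (?p - x c) ^ (w - i - 1)) * ?p ^ i) =
    mark_weight x C (w, d) c" for c
  proof -
    have "(-1) ^ i * of_nat (d choose i) * (x c * (?p - x c) ^ (w - i - 1)) * ?p ^ i =
      x c * (?p - x c) ^ (w - 1 - d) * (of_nat (d choose i) * (- ?p) ^ i * (?p - x c) ^ (d - i))"
      if "i \<le> d" for i
    proof -
      \<comment> \<open>No subtraction truncates, since \<open>i \<le> d\<close> and
        \<open>d + 1 \<le> w\<close>.\<close>
      have "w - i - 1 = (w - 1 - d) + (d - i)" using that assms by (simp add: valid_mark_def)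
      then show ?thesis by (simp add: power_add power_minus [of ?p] mult_ac)
    qed
    then have "(\<Sum>i\<le>d. (-1) ^ i * of_nat (d choose i) * (x c * (?p - x c) ^ (w - i - 1)) * ?p ^ i) =
      x c * (?p - x c) ^ (w - 1 - d) * (- ?p + (?p - x c)) ^ d"
      unfolding binomial_ring sum_distrib_left by (intro sum.cong) simp_all
    then show ?thesis by (simp add: mark_weight_def mult_ac)
  qed
  moreover have "(\<Sum>i=0..d. (-1) ^ i * of_nat (d choose i) *
      (\<Sum>c\<in>C. x c * (?p - x c) ^ (w - i - 1)) * ?p ^ i) =
    (\<Sum>c\<in>C. \<Sum>i\<le>d. (-1) ^ i * of_nat (d choose i) * (x c * (?p - x c) ^ (w - i - 1)) * ?p ^ i)"
    by (subst sum.swap) (simp add: sum_distrib_left sum_distrib_right atLeast0AtMost)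
  ultimately show ?thesis by simp
qed

theorem theorem5p14:
  fixes V :: "'a set" and E :: "'a set set" and K :: "'a marked_graph"
    and \<sigma> :: "indet \<Rightarrow> (nat, int) mpser"
  assumes "simple_graph V E"
    and "is_core_of K (unit_marked V E)"
    and "\<And>w. w \<ge> 1 \<Longrightarrow> \<sigma> (Z w 0) = star_csf w"
    and "\<sigma> Y = 0"
  shows "chrom_sym V E = subst_poly \<sigma> (D_poly K)"
proof (rule mpser_eq_restrictI)
  fix C :: "nat set" assume C: "finite C"
  define B where "B = C \<inter> {1..}"
  define x where "x = (\<lambda>c. mmonom {#c#} :: (nat, int) mpser)"
  define g where "g = (\<lambda>P. restrict_vars C (subst_poly \<sigma> P))"
  define \<tau> where "\<tau> = (\<lambda>x. case x of Y \<Rightarrow> var Y | Z w d \<Rightarrow> D_dot w d)"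
  have finB: "finite B" using C by (simp add: B_def)
  interpret g: ring_map g
    unfolding g_def by (rule ring_map_comp [OF ring_map_subst_poly ring_map_restrict_vars])
  \<comment> \<open>The composite passes from \<open>M\<close> to \<open>D\<close>, applies \<sigma>
    and then drops the variables outside \<open>C\<close>.\<close>
  have h: "ring_map (\<lambda>P. g (subst_poly \<tau> P))"
    by (rule ring_map_comp [OF ring_map_subst_poly g.ring_map_axioms])
  have star: "g (var (Z w 0)) = (\<Sum>c\<in>B. x c * (sum x B - x c) ^ (w - 1))" if "w \<ge> 1" for w
    using that finB restrict_vars_chrom_sym [OF simple_graph_star C] weighted_count_star [of B w x]
    by (simp add: g_def subst_poly_var assms star_csf_def B_def x_def)
  have star1: "g (var (Z 1 0)) = sum x B" using star [of 1] by simp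
  have dot: "g (subst_poly \<tau> (var (Z w d))) = (\<Sum>c\<in>B. mark_weight x B (w, d) c)"
    if "valid_mark (w, d)" for w d
  proof -
    \<comment> \<open>Validity gives \<open>w - i \<ge> 1\<close>, so each indeterminate here stands
      for a star with a centre.\<close>
    have "g (var (Z (w - i) 0)) = (\<Sum>c\<in>B. x c * (sum x B - x c) ^ (w - i - 1))" if "i \<le> d" for i
      using that \<open>valid_mark (w, d)\<close> by (intro star) (simp add: valid_mark_def, linarith)
    then have "g (D_dot w d) = (\<Sum>i=0..d. (-1) ^ i * of_nat (d choose i) *
      (\<Sum>c\<in>B. x c * (sum x B - x c) ^ (w - i - 1)) * sum x B ^ i)"
      unfolding D_dot_def g.map_sum
      by (intro sum.cong) (simp_all add: g.map_mult g.map_power g.map_uminus g.map_one g.map_of_nat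
          star1 del: One_nat_def diff_diff_left)
    then show ?thesis using sum_mark_weight [OF that, of x B] by (simp add: subst_poly_var \<tau>_def)
  qed
  have Y0: "g (subst_poly \<tau> (var Y)) = 0"
    using ring_map.map_zero [OF ring_map_restrict_vars]
    by (simp add: subst_poly_var \<tau>_def g_def assms)
  have wfG: "wf_marked (unit_marked V E)" using wf_unit_marked assms(1) .
  have K: "wf_marked K" "weighted_count x B K = weighted_count x B (unit_marked V E)"
    using weighted_count_absorb_steps [OF _ wfG finB] assms(2) by (auto simp: is_core_of_def)
  have "restrict_vars C (subst_poly \<sigma> (D_poly K)) = g (subst_poly \<tau> (M_poly K))"
    by (simp add: D_poly_def g_def \<tau>_def)
  also have "\<dots> = weighted_count x B K"
    using weighted_count_M_value [OF h finB Y0 dot M_value_M_poly [OF K(1)] K(1)] .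
  also have "\<dots> = restrict_vars C (chrom_sym V E)"
    using restrict_vars_chrom_sym [OF assms(1) C] K(2) by (simp add: B_def x_def)
  finally show "restrict_vars C (chrom_sym V E) = restrict_vars C (subst_poly \<sigma> (D_poly K))" ..
qed

end
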